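(* The category $\mathbf{Top}_d$ of all $d$-spaces is adequate, i.e. for every $T_0$ space $X$ the space $P_H(d(X))$ is a $d$-space. Therefore, for any $T_0$ space $X$, $X^d=P_H(d(X))$ with the canonical mapping $\eta_X: X\to X^d$, $x\mapsto\overline{\{x\}}$, is the $d$-reflection of $X$.
   Context: The specialization order on a $T_0$ space $X$ is $x\leq y$ iff $x\in\overline{\{y\}}$. A subset $U$ of a poset $P$ is Scott open if it is an upper set and, for every directed $D\subseteq P$ whose supremum exists, $\bigvee D\in U$ implies $D\cap U\neq\emptyset$; these sets form the Scott topology $\sigma(P)$. A dcpo is a poset in which every (nonempty) directed subset has a supremum. A $T_0$ space $X$ is a $d$-space if $X$ with its specialization order is a dcpo and every open set of $X$ is Scott open. $\mathbf{Top}_d$ is the category of $d$-spaces with continuous maps. For a $T_0$ space $X$, $d(X)$ is the set of all closed subsets $A\subseteq X$ such that for every continuous map $f:X\to Y$ to a $d$-space $Y$ there is a unique $y_A\in Y$ with $\overline{f(A)}=\overline{\{y_A\}}$. $P_H(d(X))$ is $d(X)$ with the lower Vietoris topology, having as a subbase the sets $\{A\in d(X): A\cap U\neq\emptyset\}$, $U$ open in $X$. A $d$-reflection of $X$ is a pair $\langle \widetilde X,\mu\rangle$ with $\widetilde X$ a $d$-space and $\mu:X\to\widetilde X$ continuous such that for every continuous $f:X\to Y$ to a $d$-space $Y$ there is a unique continuous $f^*:\widetilde X\to Y$ with $f^*\circ\mu=f$. *)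

theory Defs
  imports "HOL-Analysis.Analysis"
begin

definition directed_in :: "'a set \<Rightarrow> ('a \<times> 'a) set \<Rightarrow> 'a set \<Rightarrow> bool" where
  "directed_in P r D \<longleftrightarrow>
     D \<subseteq> P \<and> D \<noteq> {} \<and> (\<forall>x\<in>D. \<forall>y\<in>D. \<exists>z\<in>D. (x, z) \<in> r \<and> (y, z) \<in> r)"

definition is_sup_in :: "'a set \<Rightarrow> ('a \<times> 'a) set \<Rightarrow> 'a set \<Rightarrow> 'a \<Rightarrow> bool" where
  "is_sup_in P r D s \<longleftrightarrow>
     s \<in> P \<and> (\<forall>x\<in>D. (x, s) \<in> r) \<and>
     (\<forall>u\<in>P. (\<forall>x\<in>D. (x, u) \<in> r) \<longrightarrow> (s, u) \<in> r)"

definition dcpo_on :: "'a set \<Rightarrow> ('a \<times> 'a) set \<Rightarrow> bool" where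
  "dcpo_on P r \<longleftrightarrow>
     partial_order_on P r \<and> (\<forall>D. directed_in P r D \<longrightarrow> (\<exists>s. is_sup_in P r D s))"

definition scott_open_in :: "'a set \<Rightarrow> ('a \<times> 'a) set \<Rightarrow> 'a set \<Rightarrow> bool" where
  "scott_open_in P r U \<longleftrightarrow>
     U \<subseteq> P \<and>
     (\<forall>x\<in>U. \<forall>y\<in>P. (x, y) \<in> r \<longrightarrow> y \<in> U) \<and>
     (\<forall>D s. directed_in P r D \<and> is_sup_in P r D s \<and> s \<in> U \<longrightarrow> D \<inter> U \<noteq> {})"

definition spec_order :: "'a topology \<Rightarrow> ('a \<times> 'a) set" where
  "spec_order X = {(x, y). x \<in> topspace X \<and> y \<in> topspace X \<and> x \<in> X closure_of {y}}"

definition d_space :: "'a topology \<Rightarrow> bool" where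
  "d_space X \<longleftrightarrow>
     t0_space X \<and> dcpo_on (topspace X) (spec_order X) \<and>
     (\<forall>U. openin X U \<longrightarrow> scott_open_in (topspace X) (spec_order X) U)"

text \<open>The sets in d(X) are those passing a test against all d-spaces Y. HOL cannot quantify over
  all types inside a definition, so the type in which the spaces Y live is a parameter here.\<close>

definition d_sets_wrt :: "'b itself \<Rightarrow> 'a topology \<Rightarrow> 'a set set" where
  "d_sets_wrt _ X =
     {A. closedin X A \<and>
         (\<forall>(Y :: 'b topology) f. d_space Y \<and> continuous_map X Y f \<longrightarrow>
            (\<exists>!y. y \<in> topspace Y \<and> Y closure_of (f ` A) = Y closure_of {y}))}"

text \<open>d(X) itself is obtained with the type of sets of points. This loses no d-spaces: given a
  continuous f from X into a d-space of any type, let Z be the least subset of that space that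
  contains the image of f and is closed under directed suprema. A point z of Z is determined by
  the preimage under f of the closure of z, so Z has a homeomorphic copy in this type.\<close>

definition d_sets :: "'a topology \<Rightarrow> 'a set set" where
  "d_sets X = d_sets_wrt TYPE('a set) X"

text \<open>The generator G stands for the empty intersection of subbasic sets: the underlying set of
  \<^const>\<open>topology_generated_by\<close> is only the union of the generators.\<close>

definition lower_vietoris :: "'a topology \<Rightarrow> 'a set set \<Rightarrow> 'a set topology" where
  "lower_vietoris X G =
     topology_generated_by (insert G {{A \<in> G. A \<inter> U \<noteq> {}} |U. openin X U})"

definition d_completion :: "'a topology \<Rightarrow> 'a set topology" where
  "d_completion X = lower_vietoris X (d_sets X)"

definition point_closure :: "'a topology \<Rightarrow> 'a \<Rightarrow> 'a set" where
  "point_closure X x = X closure_of {x}"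

text \<open>A map between spaces matters only on the underlying set, so uniqueness is required among
  functions that are \<^const>\<open>undefined\<close> elsewhere. The first argument is the type of the
  spaces Y in the universal property.\<close>

definition d_reflection ::
  "'c itself \<Rightarrow> 'a topology \<Rightarrow> 'b topology \<Rightarrow> ('a \<Rightarrow> 'b) \<Rightarrow> bool" where
  "d_reflection _ X X' \<mu> \<longleftrightarrow>
     d_space X' \<and> continuous_map X X' \<mu> \<and>
     (\<forall>(Y :: 'c topology) f. d_space Y \<and> continuous_map X Y f \<longrightarrow>
        (\<exists>!g. g \<in> extensional (topspace X') \<and> continuous_map X' Y g \<and>
              (\<forall>x\<in>topspace X. g (\<mu> x) = f x)))"

end

theory Submission
  imports Defs
begin

text \<open>A T0 space is a d-space iff the closure of every directed set is the closure of a point, and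
  two sets have the same closure iff they meet the same open sets. Hence d(X) is closed under
  closures of directed unions, which makes the lower Vietoris space of d(X) a d-space. A map f into
  a d-space Y extends by sending A to the generic point of the closure of f(A). The extension is
  unique because the point closures of the elements of A have, in the lower Vietoris space, the
  same closure as the point A: testing A against the map x to cl{x}, itself a map into a d-space,
  gives a generic point B, and B meets the same open sets as A. To pass between types, f is
  corestricted to the set of those y in Y that are the least upper bound of the values of f below
  y: this set is closed under directed suprema, and its points are determined by subsets of X.\<close>

section \<open>Closures, the specialization order and generic points of directed sets\<close>

lemma closure_of_eq_closure_of_iff:
  "X closure_of B = X closure_of C \<longleftrightarrow>
     (\<forall>U. openin X U \<longrightarrow> (B \<inter> U = {} \<longleftrightarrow> C \<inter> U = {}))"
proof
  assume "X closure_of B = X closure_of C"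
  then show "\<forall>U. openin X U \<longrightarrow> (B \<inter> U = {} \<longleftrightarrow> C \<inter> U = {})"
    using openin_Int_closure_of_eq_empty by (metis Int_commute)
next
  assume *: "\<forall>U. openin X U \<longrightarrow> (B \<inter> U = {} \<longleftrightarrow> C \<inter> U = {})"
  have "(\<exists>y. y \<in> B \<and> y \<in> U) \<longleftrightarrow> (\<exists>y. y \<in> C \<and> y \<in> U)" if "openin X U" for U
    using * that by blast
  then show "X closure_of B = X closure_of C"
    unfolding set_eq_iff in_closure_of by (metis (no_types, lifting))
qed

lemma closure_of_eq_closure_of_singleton_iff:
  "X closure_of B = X closure_of {y} \<longleftrightarrow> (\<forall>U. openin X U \<longrightarrow> (y \<in> U \<longleftrightarrow> (\<exists>b\<in>B. b \<in> U)))"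
  unfolding closure_of_eq_closure_of_iff by blast

lemma spec_order_iff:
  "(x, y) \<in> spec_order X \<longleftrightarrow>
     x \<in> topspace X \<and> y \<in> topspace X \<and> (\<forall>U. openin X U \<longrightarrow> x \<in> U \<longrightarrow> y \<in> U)"
  by (auto simp: spec_order_def in_closure_of)

lemma t0_spaceD:
  assumes "t0_space X" "x \<in> topspace X" "y \<in> topspace X"
    and "\<And>U. openin X U \<Longrightarrow> x \<in> U \<longleftrightarrow> y \<in> U"
  shows "x = y"
  using assms unfolding t0_space_def by blast

lemma partial_order_on_spec_order:
  assumes "t0_space X"
  shows "partial_order_on (topspace X) (spec_order X)"
  unfolding partial_order_on_def preorder_on_def
proof (intro conjI)
  show "refl_on (topspace X) (spec_order X)"
    by (auto simp: refl_on_def spec_order_iff)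
  show "trans (spec_order X)"
    by (auto simp: trans_def spec_order_iff)
  show "antisym (spec_order X)"
    using t0_spaceD[OF assms] by (auto simp: antisym_def spec_order_iff)
  show "spec_order X \<subseteq> topspace X \<times> topspace X"
    by (auto simp: spec_order_iff)
qed

text \<open>If all open sets are Scott open, the supremum of a directed set lies in exactly the open
  sets that meet the directed set, so it is generic for its closure. Conversely, a generic point of
  the closure is a supremum. With this form, later arguments compare open sets only and never handle
  suprema.\<close>

lemma d_space_iff:
  "d_space X \<longleftrightarrow> t0_space X \<and>
     (\<forall>D. directed_in (topspace X) (spec_order X) D \<longrightarrow>
        (\<exists>s\<in>topspace X. X closure_of D = X closure_of {s}))"
    (is "_ \<longleftrightarrow> _ \<and> (\<forall>D. ?dir D \<longrightarrow> ?pt D)")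
proof (intro iffI conjI allI impI)
  assume X: "d_space X"
  then show "t0_space X"
    by (simp add: d_space_def)
  fix D assume D: "?dir D"
  then obtain s where s: "is_sup_in (topspace X) (spec_order X) D s"
    using X unfolding d_space_def dcpo_on_def by blast
  then have "(y, s) \<in> spec_order X" if "y \<in> D" for y
    using that by (simp add: is_sup_in_def)
  then have "y \<in> D \<Longrightarrow> y \<in> U \<Longrightarrow> s \<in> U" if "openin X U" for y U
    using that by (simp add: spec_order_iff)
  moreover have "\<exists>y\<in>D. y \<in> U" if "openin X U" "s \<in> U" for U
  proof -
    have "scott_open_in (topspace X) (spec_order X) U"
      using X that(1) by (simp add: d_space_def)
    then have "D \<inter> U \<noteq> {}"
      using D s that(2) unfolding scott_open_in_def by blast
    then show ?thesis by blast
  qed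
  ultimately have "X closure_of D = X closure_of {s}"
    unfolding closure_of_eq_closure_of_singleton_iff by blast
  then show "?pt D"
    using s unfolding is_sup_in_def by blast
next
  assume X: "t0_space X \<and> (\<forall>D. ?dir D \<longrightarrow> ?pt D)"
  have *: "\<exists>s. is_sup_in (topspace X) (spec_order X) D s \<and> X closure_of D = X closure_of {s}"
    if D: "?dir D" for D
  proof -
    obtain s where s: "s \<in> topspace X" "X closure_of D = X closure_of {s}"
      using X D by blast
    have DX: "D \<subseteq> topspace X"
      using D by (simp add: directed_in_def)
    have op: "s \<in> U \<longleftrightarrow> (\<exists>x\<in>D. x \<in> U)" if "openin X U" for U
      using s(2) that by (simp add: closure_of_eq_closure_of_singleton_iff)
    have "is_sup_in (topspace X) (spec_order X) D s"
      unfolding is_sup_in_def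
    proof (intro conjI ballI impI)
      show "(x, s) \<in> spec_order X" if "x \<in> D" for x
        using that DX s(1) op by (auto simp: spec_order_iff)
      show "(s, u) \<in> spec_order X" if "u \<in> topspace X" "\<forall>x\<in>D. (x, u) \<in> spec_order X" for u
        using that s(1) op by (auto simp: spec_order_iff)
    qed (rule s(1))
    with s show ?thesis by blast
  qed
  have po: "partial_order_on (topspace X) (spec_order X)"
    using X partial_order_on_spec_order by blast
  have "scott_open_in (topspace X) (spec_order X) U" if U: "openin X U" for U
    unfolding scott_open_in_def
  proof (intro conjI allI impI ballI)
    show "U \<subseteq> topspace X"
      using U by (rule openin_subset)
    show "y \<in> U" if "x \<in> U" "(x, y) \<in> spec_order X" for x y
      using that U by (auto simp: spec_order_iff)
    fix D s assume s: "?dir D \<and> is_sup_in (topspace X) (spec_order X) D s \<and> s \<in> U"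
    obtain t where t: "is_sup_in (topspace X) (spec_order X) D t" "X closure_of D = X closure_of {t}"
      using * s by blast
    \<comment> \<open>The given supremum \<open>s\<close> lies below the generic supremum
      \<open>t\<close>. Open sets are upper sets, so \<open>U\<close> contains \<open>t\<close>, and
      by genericity \<open>U\<close> then meets \<open>D\<close>.\<close>
    have "(s, t) \<in> spec_order X"
      using s t(1) unfolding is_sup_in_def by blast
    then have "t \<in> U"
      using s U by (auto simp: spec_order_iff)
    then have "\<exists>x\<in>D. x \<in> U"
      using t(2) U by (simp add: closure_of_eq_closure_of_singleton_iff)
    then show "D \<inter> U \<noteq> {}" by blast
  qed
  moreover have "dcpo_on (topspace X) (spec_order X)"
    unfolding dcpo_on_def using po * by blast
  ultimately show "d_space X"
    using X by (simp add: d_space_def)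
qed

lemma d_space_imp_t0_space: "d_space X \<Longrightarrow> t0_space X"
  by (simp add: d_space_iff)

section \<open>Transport of directed sets and of d-spaces along maps\<close>

lemma directed_in_spec_order_image:
  assumes D: "directed_in P r D" and f: "f ` D \<subseteq> topspace Y"
    and mono: "\<And>x y. x \<in> D \<Longrightarrow> y \<in> D \<Longrightarrow> (x, y) \<in> r \<Longrightarrow> (f x, f y) \<in> spec_order Y"
  shows "directed_in (topspace Y) (spec_order Y) (f ` D)"
  unfolding directed_in_def
proof (intro conjI ballI)
  show "f ` D \<noteq> {}"
    using D by (simp add: directed_in_def)
  fix a b assume "a \<in> f ` D" "b \<in> f ` D"
  then obtain x y where xy: "x \<in> D" "y \<in> D" "a = f x" "b = f y"
    by blast
  then obtain z where "z \<in> D" "(x, z) \<in> r" "(y, z) \<in> r"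
    using D unfolding directed_in_def by meson
  with xy show "\<exists>c\<in>f ` D. (a, c) \<in> spec_order Y \<and> (b, c) \<in> spec_order Y"
    using mono by blast
qed (rule f)

text \<open>A part of a d-space that keeps the generic points of its directed subsets is itself a
  d-space. Pulling back along an injection \<open>g\<close>, instead of taking a subspace, allows
  the copy to live in another type.\<close>

lemma d_space_pullback_topology:
  assumes Y: "d_space Y" and inj: "inj_on g A" and sub: "g ` A \<subseteq> topspace Y"
    and closed: "\<And>D y. \<lbrakk>D \<subseteq> g ` A; directed_in (topspace Y) (spec_order Y) D; y \<in> topspace Y;
                   Y closure_of D = Y closure_of {y}\<rbrakk> \<Longrightarrow> y \<in> g ` A"
  shows "d_space (pullback_topology A g Y)"
    (is "d_space ?T")
proof -
  have top: "topspace ?T = A"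
    using sub by (auto simp: topspace_pullback_topology)
  have op: "openin ?T V \<longleftrightarrow> (\<exists>U. openin Y U \<and> V = g -` U \<inter> A)" for V
    by (auto simp: openin_pullback_topology)
  have "t0_space ?T"
    unfolding t0_space_def top
  proof (intro ballI impI)
    fix x y assume xy: "x \<in> A" "y \<in> A" "x \<noteq> y"
    then have "g x \<noteq> g y" "g x \<in> topspace Y" "g y \<in> topspace Y"
      using inj sub by (auto simp: inj_on_def)
    then obtain U where "openin Y U" "g x \<notin> U \<longleftrightarrow> g y \<in> U"
      using d_space_imp_t0_space[OF Y] unfolding t0_space_def by blast
    then show "\<exists>V. openin ?T V \<and> (x \<notin> V \<longleftrightarrow> y \<in> V)"
      using xy unfolding op by (intro exI[of _ "g -` U \<inter> A"]) auto
  qed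
  moreover have "\<exists>s\<in>topspace ?T. ?T closure_of D = ?T closure_of {s}"
    if D: "directed_in (topspace ?T) (spec_order ?T) D" for D
  proof -
    have DA: "D \<subseteq> A"
      using D by (simp add: directed_in_def top)
    have "directed_in (topspace Y) (spec_order Y) (g ` D)"
    proof (rule directed_in_spec_order_image[OF D])
      show "g ` D \<subseteq> topspace Y"
        using DA sub by blast
      show "(g x, g y) \<in> spec_order Y" if "(x, y) \<in> spec_order ?T" for x y
        using that sub unfolding spec_order_iff top op by blast
    qed
    moreover from this obtain y where y: "y \<in> topspace Y" "Y closure_of (g ` D) = Y closure_of {y}"
      using Y unfolding d_space_iff by blast
    ultimately obtain s where s: "s \<in> A" "y = g s"
      using closed[of "g ` D" y] DA by blast
    have "?T closure_of D = ?T closure_of {s}"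
      using y s DA unfolding closure_of_eq_closure_of_singleton_iff op by blast
    then show ?thesis
      using s top by blast
  qed
  ultimately show ?thesis
    by (simp add: d_space_iff)
qed

section \<open>The sets in d(X) and their independence of the type of the test spaces\<close>

lemma d_sets_wrt_iff:
  "A \<in> d_sets_wrt (t :: 'b itself) X \<longleftrightarrow> closedin X A \<and>
     (\<forall>(Y :: 'b topology) f. d_space Y \<longrightarrow> continuous_map X Y f \<longrightarrow>
        (\<exists>y\<in>topspace Y. Y closure_of (f ` A) = Y closure_of {y}))"
proof -
  \<comment> \<open>Generic points in a T0 space are unique, so only their existence has to be
    tested.\<close>
  have "y = y'" if "d_space Y" "y \<in> topspace Y" "y' \<in> topspace Y"
      "Y closure_of {y} = Y closure_of {y'}" for Y :: "'b topology" and y y'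
    using t0_spaceD[OF d_space_imp_t0_space[OF that(1)] that(2,3)] that(4)
    by (simp add: closure_of_eq_closure_of_singleton_iff)
  then have "(\<exists>!y. y \<in> topspace Y \<and> Y closure_of B = Y closure_of {y}) \<longleftrightarrow>
      (\<exists>y\<in>topspace Y. Y closure_of B = Y closure_of {y})" if "d_space Y" for Y :: "'b topology" and B
    using that by metis
  then show ?thesis
    by (simp add: d_sets_wrt_def imp_conjL)
qed

text \<open>A map into a d-space \<open>Y\<close> of any type factors through a part
  \<open>S\<close> of \<open>Y\<close> whose points can be coded by subsets of \<open>X\<close>. The
  coded copy of \<open>S\<close> is a test space for \<open>d_sets\<close>, and the generic point
  found there is decoded into \<open>Y\<close>.\<close>

lemma d_sets_subset_d_sets_wrt:
  fixes X :: "'a topology"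
  shows "d_sets X \<subseteq> d_sets_wrt TYPE('c) X"
proof
  fix A assume A: "A \<in> d_sets X"
  have clA: "closedin X A"
    using A by (simp add: d_sets_def d_sets_wrt_iff)
  have "\<exists>y\<in>topspace Y. Y closure_of (f ` A) = Y closure_of {y}"
    if Y: "d_space Y" and f: "continuous_map X Y f" for Y :: "'c topology" and f
  proof -
    \<comment> \<open>The set \<open>h y\<close> is the preimage under \<open>f\<close> of the
      closure of \<open>y\<close> and serves as the code of \<open>y\<close>. The condition
      \<open>h y \<subseteq> h w\<close> says that \<open>w\<close> bounds all values of
      \<open>f\<close> below \<open>y\<close>, so \<open>S\<close> collects the points that are
      least such bounds. The map \<open>g\<close> decodes, and \<open>T\<close> is \<open>S\<close>
      carried over to the codes.\<close>
    define h where "h y = {x \<in> topspace X. (f x, y) \<in> spec_order Y}" for y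
    define S where "S = {y \<in> topspace Y. \<forall>w\<in>topspace Y. h y \<subseteq> h w \<longrightarrow> (y, w) \<in> spec_order Y}"
    define g where "g = inv_into S h"
    define T where "T = pullback_topology (h ` S) g Y"
    have fY: "f x \<in> topspace Y" if "x \<in> topspace X" for x
      using f that by (auto simp: continuous_map_def)
    have fS: "f x \<in> S" if x: "x \<in> topspace X" for x
      unfolding S_def
    proof (clarify, intro conjI ballI impI)
      show "f x \<in> topspace Y"
        using fY x .
      have "x \<in> h (f x)"
        using x fY by (simp add: h_def spec_order_iff)
      then show "(f x, w) \<in> spec_order Y" if "h (f x) \<subseteq> h w" for w
        using that by (auto simp: h_def)
    qed
    have inj_h: "inj_on h S"
    proof (rule inj_onI)
      fix y z assume "y \<in> S" "z \<in> S" "h y = h z"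
      then have "(y, z) \<in> spec_order Y" "(z, y) \<in> spec_order Y"
        by (auto simp: S_def)
      then show "y = z"
        using partial_order_on_spec_order[OF d_space_imp_t0_space[OF Y]]
        by (auto simp: partial_order_on_def antisym_def)
    qed
    then have gh: "g (h y) = y" if "y \<in> S" for y
      using that by (simp add: g_def)
    have gS: "g ` h ` S = S"
      using gh by force
    have "d_space T"
      unfolding T_def
    proof (rule d_space_pullback_topology[OF Y])
      show "inj_on g (h ` S)"
        unfolding g_def by (rule inj_on_inv_into) simp
      show "g ` h ` S \<subseteq> topspace Y"
        unfolding gS by (auto simp: S_def)
      fix D y
      assume D: "D \<subseteq> g ` h ` S" and y: "y \<in> topspace Y" and cl: "Y closure_of D = Y closure_of {y}"
      \<comment> \<open>Each \<open>d\<close> in \<open>D\<close> lies below \<open>y\<close>, hence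
        \<open>h d \<subseteq> h y \<subseteq> h w\<close>, and \<open>d \<in> S\<close> puts
        \<open>d\<close> below \<open>w\<close>. An open set around \<open>y\<close> contains some
        such \<open>d\<close> and therefore also \<open>w\<close>.\<close>
      have "(y, w) \<in> spec_order Y" if w: "w \<in> topspace Y" "h y \<subseteq> h w" for w
      proof -
        have "(d, w) \<in> spec_order Y" if d: "d \<in> D" for d
        proof -
          have "d \<in> S"
            using D d gS by blast
          moreover from this have "(d, y) \<in> spec_order Y"
            using cl d y unfolding closure_of_eq_closure_of_singleton_iff spec_order_iff S_def by blast
          then have "h d \<subseteq> h y"
            by (auto simp: h_def spec_order_iff)
          ultimately show ?thesis
            using w unfolding S_def by blast
        qed
        then show ?thesis
          using cl y w unfolding closure_of_eq_closure_of_singleton_iff spec_order_iff by blast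
      qed
      then show "y \<in> g ` h ` S"
        unfolding gS using y by (simp add: S_def)
    qed
    moreover have "continuous_map X T (h \<circ> f)"
      unfolding T_def
    proof (rule continuous_map_pullback')
      show "continuous_map X Y (g \<circ> (h \<circ> f))"
        by (rule continuous_map_eq[OF f]) (simp add: gh fS)
      show "topspace X \<subseteq> (h \<circ> f) -` h ` S"
        using fS by auto
    qed
    ultimately obtain t where t: "t \<in> topspace T" "T closure_of ((h \<circ> f) ` A) = T closure_of {t}"
      using A unfolding d_sets_def d_sets_wrt_iff by blast
    then obtain s where s: "s \<in> S" "t = h s"
      by (auto simp: T_def topspace_pullback_topology)
    \<comment> \<open>Open sets of \<open>Y\<close> leave open traces on the codes. Hence the
      genericity of \<open>t\<close> in \<open>T\<close> yields that of the decoded point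
      \<open>s\<close> in \<open>Y\<close>.\<close>
    have op: "openin T (g -` U \<inter> h ` S)" if "openin Y U" for U
      using that by (auto simp: T_def openin_pullback_topology)
    have "s \<in> U \<longleftrightarrow> (\<exists>b\<in>f ` A. b \<in> U)" if U: "openin Y U" for U
    proof -
      have "A \<subseteq> topspace X"
        using clA by (rule closedin_subset)
      then have *: "a \<in> A \<Longrightarrow> f a \<in> S" for a
        using fS by blast
      have "h s \<in> g -` U \<inter> h ` S \<longleftrightarrow> (\<exists>b\<in>(h \<circ> f) ` A. b \<in> g -` U \<inter> h ` S)"
        using t(2) op[OF U] s(2) unfolding closure_of_eq_closure_of_singleton_iff by blast
      then show ?thesis
        using s(1) gh * by auto
    qed
    then have "Y closure_of (f ` A) = Y closure_of {s}"
      unfolding closure_of_eq_closure_of_singleton_iff by blast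
    then show ?thesis
      using s unfolding S_def by blast
  qed
  then show "A \<in> d_sets_wrt TYPE('c) X"
    using clA by (simp add: d_sets_wrt_iff)
qed

section \<open>The lower Vietoris topology on a family of closed sets\<close>

lemma topspace_lower_vietoris [simp]: "topspace (lower_vietoris X G) = G"
  by (auto simp: lower_vietoris_def)

lemma openin_lower_vietoris_subbase:
  "openin X U \<Longrightarrow> openin (lower_vietoris X G) {A \<in> G. A \<inter> U \<noteq> {}}"
  unfolding lower_vietoris_def by (rule topology_generated_by_Basis) auto

lemma continuous_map_into_lower_vietoris:
  assumes "f \<in> topspace Y \<rightarrow> G"
    and "\<And>U. openin X U \<Longrightarrow> openin Y {y \<in> topspace Y. f y \<inter> U \<noteq> {}}"
  shows "continuous_map Y (lower_vietoris X G) f"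
proof -
  have "f -` {A \<in> G. A \<inter> U \<noteq> {}} \<inter> topspace Y = {y \<in> topspace Y. f y \<inter> U \<noteq> {}}" for U
    using assms(1) by auto
  moreover have "f -` G \<inter> topspace Y = topspace Y"
    using assms(1) by auto
  ultimately show ?thesis
    unfolding lower_vietoris_def continuous_on_generated_topo_iff using assms by auto
qed

text \<open>The complement of the closed set \<open>B\<close> is an open set that \<open>B\<close>
  misses, so a set \<open>A\<close> below \<open>B\<close> must miss it too. Conversely, subbasic
  sets are upper sets for inclusion, and finite intersections and unions preserve this.\<close>

lemma spec_order_lower_vietoris:
  assumes G: "\<And>A. A \<in> G \<Longrightarrow> closedin X A"
  shows "(A, B) \<in> spec_order (lower_vietoris X G) \<longleftrightarrow> A \<in> G \<and> B \<in> G \<and> A \<subseteq> B"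
proof (intro iffI)
  assume AB: "(A, B) \<in> spec_order (lower_vietoris X G)"
  then have *: "A \<in> G" "B \<in> G"
    by (simp_all add: spec_order_iff)
  then have "openin X (topspace X - B)" "A \<subseteq> topspace X"
    using G by (auto dest: closedin_subset)
  then show "A \<in> G \<and> B \<in> G \<and> A \<subseteq> B"
    using AB * openin_lower_vietoris_subbase[of X "topspace X - B" G]
    unfolding spec_order_iff by fastforce
next
  assume AB: "A \<in> G \<and> B \<in> G \<and> A \<subseteq> B"
  have "A \<in> W \<longrightarrow> B \<in> W"
    if "generate_topology_on (insert G {{A \<in> G. A \<inter> U \<noteq> {}} |U. openin X U}) W" for W
    using that by induction (use AB in auto)
  then show "(A, B) \<in> spec_order (lower_vietoris X G)"
    using AB by (auto simp: spec_order_iff lower_vietoris_def openin_topology_generated_by_iff)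
qed

lemma t0_space_lower_vietoris:
  assumes G: "\<And>A. A \<in> G \<Longrightarrow> closedin X A"
  shows "t0_space (lower_vietoris X G)"
  unfolding t0_space_def
proof (intro ballI impI, rule ccontr)
  fix A B
  assume AB: "A \<in> topspace (lower_vietoris X G)" "B \<in> topspace (lower_vietoris X G)" "A \<noteq> B"
    and "\<nexists>U. openin (lower_vietoris X G) U \<and> (A \<notin> U \<longleftrightarrow> B \<in> U)"
  then have "(A, B) \<in> spec_order (lower_vietoris X G)" "(B, A) \<in> spec_order (lower_vietoris X G)"
    by (auto simp: spec_order_iff)
  then show False
    using AB(3) by (simp add: spec_order_lower_vietoris[OF G])
qed

section \<open>Members of d(X): point closures and closures of directed unions\<close>

lemma closure_of_image_closure_of:
  assumes f: "continuous_map X Y f" and B: "B \<subseteq> topspace X"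
  shows "Y closure_of (f ` (X closure_of B)) = Y closure_of (f ` B)"
proof (rule antisym)
  show "Y closure_of (f ` (X closure_of B)) \<subseteq> Y closure_of (f ` B)"
    using f by (intro closure_of_minimal closedin_closure_of) (simp add: continuous_map_image_closure_subset)
  show "Y closure_of (f ` B) \<subseteq> Y closure_of (f ` (X closure_of B))"
    using closure_of_subset[OF B] by (intro closure_of_mono image_mono)
qed

text \<open>By continuity \<open>f x\<close> is the required generic point for every test map
  \<open>f\<close>.\<close>

lemma point_closure_in_d_sets:
  assumes "x \<in> topspace X"
  shows "point_closure X x \<in> d_sets X"
  unfolding d_sets_def d_sets_wrt_iff
proof (intro conjI allI impI)
  show "closedin X (point_closure X x)"
    by (simp add: point_closure_def)
  fix Y :: "'a set topology" and f assume f: "continuous_map X Y f"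
  then have "f x \<in> topspace Y"
    using assms by (auto simp: continuous_map_def)
  moreover have "Y closure_of (f ` point_closure X x) = Y closure_of {f x}"
    using closure_of_image_closure_of[OF f, of "{x}"] assms by (simp add: point_closure_def)
  ultimately show "\<exists>y\<in>topspace Y. Y closure_of (f ` point_closure X x) = Y closure_of {y}"
    by blast
qed

text \<open>For a test map \<open>f\<close>, a larger member of \<open>D\<close> has a larger
  generic point, so these points form a directed set in \<open>Y\<close>. Its generic point also
  serves the closure of the union. The relation \<open>r\<close> need only imply inclusion, so the
  specialization order of the lower Vietoris space can take its place.\<close>

lemma closure_of_directed_Union_in_d_sets_wrt:
  assumes D: "directed_in (d_sets_wrt (t :: 'b itself) X) r D"
    and r: "\<And>A B. (A, B) \<in> r \<Longrightarrow> A \<subseteq> B"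
  shows "X closure_of (\<Union>D) \<in> d_sets_wrt t X"
  unfolding d_sets_wrt_iff
proof (intro conjI allI impI)
  fix Y :: "'b topology" and f assume Y: "d_space Y" and f: "continuous_map X Y f"
  have DX: "D \<subseteq> d_sets_wrt t X"
    using D by (simp add: directed_in_def)
  then have "\<forall>A\<in>D. \<exists>y\<in>topspace Y. Y closure_of (f ` A) = Y closure_of {y}"
    using Y f by (auto simp: d_sets_wrt_iff)
  then obtain p where p: "\<And>A. A \<in> D \<Longrightarrow> p A \<in> topspace Y"
      "\<And>A. A \<in> D \<Longrightarrow> Y closure_of (f ` A) = Y closure_of {p A}"
    by metis
  have "directed_in (topspace Y) (spec_order Y) (p ` D)"
  proof (rule directed_in_spec_order_image[OF D])
    show "p ` D \<subseteq> topspace Y"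
      using p by blast
    show "(p A, p B) \<in> spec_order Y" if "A \<in> D" "B \<in> D" "(A, B) \<in> r" for A B
      using p[OF that(1)] p[OF that(2)] r[OF that(3)]
      unfolding closure_of_eq_closure_of_singleton_iff spec_order_iff by blast
  qed
  then obtain y where y: "y \<in> topspace Y" "Y closure_of (p ` D) = Y closure_of {y}"
    using Y unfolding d_space_iff by blast
  have "y \<in> U \<longleftrightarrow> (\<exists>b\<in>f ` \<Union>D. b \<in> U)" if U: "openin Y U" for U
  proof -
    have "y \<in> U \<longleftrightarrow> (\<exists>A\<in>D. p A \<in> U)"
      using y(2) U by (simp add: closure_of_eq_closure_of_singleton_iff)
    also have "\<dots> \<longleftrightarrow> (\<exists>A\<in>D. \<exists>a\<in>A. f a \<in> U)"
      using p(2) U by (simp add: closure_of_eq_closure_of_singleton_iff)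
    finally show ?thesis by blast
  qed
  then have "Y closure_of (f ` \<Union>D) = Y closure_of {y}"
    unfolding closure_of_eq_closure_of_singleton_iff by blast
  moreover have "\<Union>D \<subseteq> topspace X"
  proof (rule Union_least)
    fix A assume "A \<in> D"
    with DX have "A \<in> d_sets_wrt t X" ..
    then show "A \<subseteq> topspace X"
      by (simp add: d_sets_wrt_iff closedin_subset)
  qed
  ultimately have "Y closure_of (f ` (X closure_of \<Union>D)) = Y closure_of {y}"
    using closure_of_image_closure_of[OF f] by metis
  then show "\<exists>y\<in>topspace Y. Y closure_of (f ` (X closure_of \<Union>D)) = Y closure_of {y}"
    using y(1) by (rule bexI)
qed simp

section \<open>The lower Vietoris space of d(X) is a d-space\<close>

lemma closedin_d_sets: "A \<in> d_sets X \<Longrightarrow> closedin X A"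
  by (simp add: d_sets_def d_sets_wrt_iff)

text \<open>The closure of the union of a directed family \<open>D\<close> is its generic point. It
  contains every member of \<open>D\<close>, so it lies in every open set that meets
  \<open>D\<close>. The converse goes by induction on how the open set is generated.\<close>

lemma d_space_lower_vietoris_d_sets: "d_space (lower_vietoris X (d_sets X))"
    (is "d_space ?V")
  unfolding d_space_iff
proof (intro conjI allI impI)
  show "t0_space ?V"
    using closedin_d_sets by (rule t0_space_lower_vietoris)
  fix D assume "directed_in (topspace ?V) (spec_order ?V) D"
  then have D: "directed_in (d_sets X) (spec_order ?V) D"
    by simp
  have le: "(A, B) \<in> spec_order ?V \<longleftrightarrow> A \<in> d_sets X \<and> B \<in> d_sets X \<and> A \<subseteq> B" for A B
    by (rule spec_order_lower_vietoris) (rule closedin_d_sets)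
  let ?s = "X closure_of \<Union>D"
  have s: "?s \<in> d_sets X"
    by (rule closure_of_directed_Union_in_d_sets_wrt[of "TYPE('a set)" X, folded d_sets_def, OF D])
      (simp add: le)
  have DX: "D \<subseteq> d_sets X"
    and ne: "D \<noteq> {}"
    using D by (simp_all add: directed_in_def)
  have dir: "\<exists>C\<in>D. A \<subseteq> C \<and> B \<subseteq> C" if "A \<in> D" "B \<in> D" for A B
  proof -
    have "\<exists>C\<in>D. (A, C) \<in> spec_order ?V \<and> (B, C) \<in> spec_order ?V"
      using D that by (simp add: directed_in_def)
    then show ?thesis
      unfolding le by blast
  qed
  have "\<Union>D \<subseteq> topspace X"
    using DX by (auto dest: closedin_d_sets closedin_subset)
  then have le_s: "(A, ?s) \<in> spec_order ?V" if "A \<in> D" for A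
    using that s DX closure_of_subset[of "\<Union>D" X] unfolding le by blast
  have up: "B \<in> W" if "openin ?V W" "A \<in> W" "A \<in> D" "B \<in> D" "A \<subseteq> B" for A B W
  proof -
    have "(A, B) \<in> spec_order ?V"
      using that DX unfolding le by blast
    then show ?thesis
      using that by (auto simp: spec_order_iff)
  qed
  have "\<exists>A\<in>D. A \<in> W" if "openin ?V W" "?s \<in> W" for W
  proof -
    have "generate_topology_on (insert (d_sets X) {{A \<in> d_sets X. A \<inter> U \<noteq> {}} |U. openin X U}) W"
      using that(1) by (simp add: lower_vietoris_def openin_topology_generated_by_iff)
    then show ?thesis
      using that(2)
    proof induction
      case Empty
      then show ?case by simp
    next
      case (Int W1 W2)
      \<comment> \<open>The induction hypotheses give a member of \<open>D\<close> in
        \<open>W1\<close> and another in \<open>W2\<close>. By directedness some member contains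
        both, and it lies in both open sets because these are upper sets.\<close>
      then obtain A B where "A \<in> D" "A \<in> W1" "B \<in> D" "B \<in> W2"
        by blast
      moreover have "openin ?V W1" "openin ?V W2"
        using Int.hyps by (simp_all add: lower_vietoris_def openin_topology_generated_by_iff)
      ultimately show ?case
        using dir[of A B] up by blast
    next
      case (UN K)
      then show ?case by blast
    next
      case (Basis W)
      then consider "W = d_sets X" | U where "openin X U" "W = {A \<in> d_sets X. A \<inter> U \<noteq> {}}"
        by blast
      then show ?case
      proof cases
        case 1
        then show ?thesis using ne DX by blast
      next
        case 2
        \<comment> \<open>An open set that meets the closure of the union meets the union itself,
          hence some member of \<open>D\<close>.\<close>
        then have "\<Union>D \<inter> U \<noteq> {}"
          using Basis.prems openin_Int_closure_of_eq_empty[of X U "\<Union>D"] by blast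
        then show ?thesis using 2 DX by blast
      qed
    qed
  qed
  moreover have "?s \<in> W" if "openin ?V W" "A \<in> D" "A \<in> W" for A W
    using le_s[OF that(2)] that by (auto simp: spec_order_iff)
  ultimately have "?V closure_of D = ?V closure_of {?s}"
    unfolding closure_of_eq_closure_of_singleton_iff by blast
  then show "\<exists>s\<in>topspace ?V. ?V closure_of D = ?V closure_of {s}"
    using s by auto
qed

section \<open>The universal property of the point closure map\<close>

lemma point_closure_Int_eq_empty_iff:
  assumes "openin X U" "x \<in> topspace X"
  shows "point_closure X x \<inter> U = {} \<longleftrightarrow> x \<notin> U"
  using openin_Int_closure_of_eq_empty[OF assms(1), of "{x}"] by (auto simp: point_closure_def)

lemma continuous_map_point_closure: "continuous_map X (d_completion X) (point_closure X)"
  unfolding d_completion_def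
proof (rule continuous_map_into_lower_vietoris)
  show "point_closure X \<in> topspace X \<rightarrow> d_sets X"
    by (intro Pi_I point_closure_in_d_sets)
  fix U assume U: "openin X U"
  then have "{x \<in> topspace X. point_closure X x \<inter> U \<noteq> {}} = U"
    using point_closure_Int_eq_empty_iff[OF U] openin_subset[OF U] by blast
  then show "openin X {x \<in> topspace X. point_closure X x \<inter> U \<noteq> {}}"
    using U by simp
qed

text \<open>This density statement gives the uniqueness of extensions. The points of
  \<open>d_completion X\<close> have type \<open>'a set\<close>, so this space is among the test
  spaces in \<open>d_sets\<close>, and \<open>A\<close> can be tested against the point closure map.
  The resulting generic point \<open>B\<close> meets the same open sets of \<open>X\<close> as
  \<open>A\<close>; both are closed, so they coincide.\<close>

lemma closure_of_point_closures:
  assumes A: "A \<in> d_sets X"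
  shows "d_completion X closure_of (point_closure X ` A) = d_completion X closure_of {A}"
proof -
  let ?V = "d_completion X"
  have "d_space ?V"
    using d_space_lower_vietoris_d_sets by (simp add: d_completion_def)
  then obtain B where B: "B \<in> topspace ?V" "?V closure_of (point_closure X ` A) = ?V closure_of {B}"
    using A continuous_map_point_closure unfolding d_sets_def d_sets_wrt_iff by blast
  then have B': "B \<in> d_sets X"
    by (simp add: d_completion_def)
  have AX: "A \<subseteq> topspace X"
    using closedin_d_sets[OF A] by (rule closedin_subset)
  have "A \<inter> U = {} \<longleftrightarrow> B \<inter> U = {}" if U: "openin X U" for U
  proof -
    have "openin ?V {C \<in> d_sets X. C \<inter> U \<noteq> {}}"
      using openin_lower_vietoris_subbase[OF U] by (simp add: d_completion_def)
    then have "B \<in> {C \<in> d_sets X. C \<inter> U \<noteq> {}} \<longleftrightarrow>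
        (\<exists>b\<in>point_closure X ` A. b \<in> {C \<in> d_sets X. C \<inter> U \<noteq> {}})"
      using B(2)[unfolded closure_of_eq_closure_of_singleton_iff] by (elim allE impE)
    then have "B \<inter> U \<noteq> {} \<longleftrightarrow> (\<exists>a\<in>A. point_closure X a \<in> d_sets X \<and> point_closure X a \<inter> U \<noteq> {})"
      using B' by simp
    also have "\<dots> \<longleftrightarrow> A \<inter> U \<noteq> {}"
    proof -
      have "point_closure X a \<in> d_sets X \<and> point_closure X a \<inter> U \<noteq> {} \<longleftrightarrow> a \<in> U" if "a \<in> A" for a
        using that AX point_closure_Int_eq_empty_iff[OF U, of a] point_closure_in_d_sets[of a X] by auto
      then show ?thesis by auto
    qed
    finally show ?thesis by blast
  qed
  then have "X closure_of A = X closure_of B"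
    by (simp add: closure_of_eq_closure_of_iff)
  then have "A = B"
    using closedin_d_sets A B' closure_of_closedin by metis
  then show ?thesis
    using B(2) by simp
qed

lemma d_reflection_d_completion: "d_reflection TYPE('c) X (d_completion X) (point_closure X)"
  unfolding d_reflection_def
proof (intro conjI allI impI)
  let ?V = "d_completion X"
  show "d_space ?V"
    using d_space_lower_vietoris_d_sets by (simp add: d_completion_def)
  show "continuous_map X ?V (point_closure X)"
    by (rule continuous_map_point_closure)
  have top: "topspace ?V = d_sets X"
    by (simp add: d_completion_def)
  fix Y :: "'c topology" and f assume *: "d_space Y \<and> continuous_map X Y f"
  then have Y: "d_space Y" and f: "continuous_map X Y f"
    by auto
  have fY: "f x \<in> topspace Y" if "x \<in> topspace X" for x
    using f that by (auto simp: continuous_map_def)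
  have dX: "A \<subseteq> topspace X" if "A \<in> d_sets X" for A
    using closedin_d_sets[OF that] by (rule closedin_subset)
  have "\<exists>y\<in>topspace Y. Y closure_of (f ` A) = Y closure_of {y}" if "A \<in> d_sets X" for A
  proof -
    have "A \<in> d_sets_wrt TYPE('c) X"
      using that by (rule subsetD[OF d_sets_subset_d_sets_wrt])
    then show ?thesis
      using Y f by (simp add: d_sets_wrt_iff)
  qed
  \<comment> \<open>The extension sends \<open>A\<close> to the generic point \<open>p A\<close> of
    the closure of its image under \<open>f\<close>; \<open>g\<close> is \<open>p\<close> made
    extensional.\<close>
  then obtain p where p: "\<And>A. A \<in> d_sets X \<Longrightarrow> p A \<in> topspace Y"
      "\<And>A. A \<in> d_sets X \<Longrightarrow> Y closure_of (f ` A) = Y closure_of {p A}"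
    by metis
  have p_iff: "p A \<in> U \<longleftrightarrow> (\<exists>a\<in>A. f a \<in> U)" if "A \<in> d_sets X" "openin Y U" for A U
    using p(2)[OF that(1)] that(2) by (simp add: closure_of_eq_closure_of_singleton_iff)
  define g where "g = restrict p (d_sets X)"
  show "\<exists>!g. g \<in> extensional (topspace ?V) \<and> continuous_map ?V Y g \<and>
              (\<forall>x\<in>topspace X. g (point_closure X x) = f x)"
  proof (intro ex1I[of _ g] conjI ballI)
    show "g \<in> extensional (topspace ?V)"
      by (simp add: g_def top)
    show "continuous_map ?V Y g"
      unfolding continuous_map_def top
    proof (intro conjI allI impI)
      show "g \<in> d_sets X \<rightarrow> topspace Y"
        using p(1) by (simp add: g_def)
      fix U assume U: "openin Y U"
      \<comment> \<open>The preimage of \<open>U\<close> under \<open>g\<close> is the subbasic set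
        given by the preimage of \<open>U\<close> under \<open>f\<close>, whence continuity.\<close>
      have "{A \<in> d_sets X. g A \<in> U} = {A \<in> d_sets X. A \<inter> {x \<in> topspace X. f x \<in> U} \<noteq> {}}"
        using p_iff[OF _ U] dX by (fastforce simp: g_def)
      then show "openin ?V {A \<in> d_sets X. g A \<in> U}"
        using openin_continuous_map_preimage[OF f U] openin_lower_vietoris_subbase
        by (simp add: d_completion_def)
    qed
    fix x assume x: "x \<in> topspace X"
    have xd: "point_closure X x \<in> d_sets X"
      using x by (rule point_closure_in_d_sets)
    have "p (point_closure X x) \<in> U \<longleftrightarrow> f x \<in> U" if U: "openin Y U" for U
    proof -
      have "p (point_closure X x) \<in> U \<longleftrightarrow> point_closure X x \<inter> {x \<in> topspace X. f x \<in> U} \<noteq> {}"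
        using p_iff[OF xd U] dX[OF xd] by blast
      then show ?thesis
        using point_closure_Int_eq_empty_iff[OF openin_continuous_map_preimage[OF f U] x] x by simp
    qed
    then have "p (point_closure X x) = f x"
      using t0_spaceD[OF d_space_imp_t0_space[OF Y]] p(1)[OF xd] fY[OF x] by blast
    then show "g (point_closure X x) = f x"
      using xd by (simp add: g_def)
  next
    fix k assume k: "k \<in> extensional (topspace ?V) \<and> continuous_map ?V Y k \<and>
              (\<forall>x\<in>topspace X. k (point_closure X x) = f x)"
    show "k = g"
    proof (rule extensionalityI[of _ "d_sets X"])
      show "k \<in> extensional (d_sets X)" "g \<in> extensional (d_sets X)"
        using k by (auto simp: g_def top)
      fix A assume A: "A \<in> d_sets X"
      have "k A \<in> U \<longleftrightarrow> p A \<in> U" if U: "openin Y U" for U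
      proof -
        have "openin ?V {B \<in> topspace ?V. k B \<in> U}"
          using k U by (auto intro: openin_continuous_map_preimage)
        \<comment> \<open>The preimage of \<open>U\<close> under \<open>k\<close> is open, so it
          contains \<open>A\<close> iff it contains the closure of some point of \<open>A\<close>.
          There \<open>k\<close> is prescribed by \<open>f\<close>.\<close>
        then have "k A \<in> U \<longleftrightarrow> (\<exists>a\<in>A. point_closure X a \<in> d_sets X \<and> k (point_closure X a) \<in> U)"
          using closure_of_point_closures[OF A] A
          unfolding closure_of_eq_closure_of_singleton_iff top by blast
        also have "\<dots> \<longleftrightarrow> (\<exists>a\<in>A. f a \<in> U)"
          using k dX[OF A] point_closure_in_d_sets by (metis subsetD)
        finally show ?thesis
          using p_iff[OF A U] by simp
      qed
      moreover have "k A \<in> topspace Y"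
        using k A by (auto simp: continuous_map_def top)
      ultimately show "k A = g A"
        using t0_spaceD[OF d_space_imp_t0_space[OF Y]] p(1)[OF A] A by (simp add: g_def)
    qed
  qed
qed

theorem theorem5p4:
  fixes X :: "'a topology"
  assumes "t0_space X"
  shows "d_space (lower_vietoris X (d_sets X)) \<and>
         d_reflection TYPE('c) X (d_completion X) (point_closure X) \<and>
         d_sets X \<subseteq> d_sets_wrt TYPE('c) X"
  using d_space_lower_vietoris_d_sets d_reflection_d_completion d_sets_subset_d_sets_wrt by blast

end
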